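(* Let $k\in\mathbb{R}$, $k\neq 0$. The function $f_k(z)=\theta(k^2-z)$ on $\mathbb{R}_+=(0,\infty)$ is not in the image of the Laplace transform of a positive measure on the positive real line; that is, there is no positive Borel measure $\mu$ on $[0,\infty)$ such that $$\theta(k^2-z)=\int_{[0,\infty)} e^{-zt}\, d\mu(t)\qquad\text{for all } z\in\mathbb{R}_+ .$$
   Context: $\theta$ is the Heaviside step function: $\theta(x)=1$ for $x>0$ and $\theta(x)=0$ for $x<0$ (with any fixed convention for the value $\theta(0)$). The Laplace transform of a positive measure $\mu$ on $[0,\infty)$ is $z\mapsto\int_{[0,\infty)}e^{-zt}\,d\mu(t)$. *)

theory Defs
  imports "HOL-Analysis.Analysis"
begin

text \<open>The parameter \<open>c\<close> is the value at \<open>0\<close>, for which no convention is fixed.\<close>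

definition heaviside :: "real \<Rightarrow> real \<Rightarrow> real" where
  "heaviside c x = (if x > 0 then 1 else if x < 0 then 0 else c)"

text \<open>A positive Borel measure on \<open>[0,\<infinity>)\<close>; the space of \<open>\<mu>\<close> is then \<open>{0..}\<close>. No finiteness is required.\<close>

definition borel_measure_on_nonneg :: "real measure \<Rightarrow> bool" where
  "borel_measure_on_nonneg \<mu> \<longleftrightarrow> sets \<mu> = sets (restrict_space borel {0..})"

text \<open>The integrand is positive, so the integral always exists in \<open>[0,\<infinity>]\<close>. Taking it there
  (rather than the real-valued integral, which is \<open>0\<close> by convention for non-integrable functions)
  makes an equation with a real number include the finiteness of the integral.\<close>

definition laplace_transform :: "real measure \<Rightarrow> real \<Rightarrow> ennreal" where
  "laplace_transform \<mu> z = (\<integral>\<^sup>+ t. ennreal (exp (- z * t)) \<partial>\<mu>)"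

end

theory Submission
  imports Defs
begin

text \<open>The integrand \<open>exp (- z * t)\<close> never vanishes, so if the Laplace transform is zero at a single
  point, the measure is null and the transform is zero everywhere. The step function, however, takes
  both values \<open>0\<close> and \<open>1\<close> on the positive half-line.\<close>

lemma laplace_transform_eq_0:
  assumes "borel_measure_on_nonneg \<mu>" and "laplace_transform \<mu> w = 0"
  shows "laplace_transform \<mu> z = 0"
proof -
  have sets_\<mu>: "sets \<mu> = sets (restrict_space borel {0..})"
    using assms(1) by (simp add: borel_measure_on_nonneg_def)
  have meas: "(\<lambda>t. ennreal (exp (- x * t))) \<in> borel_measurable \<mu>" for x
    by (subst measurable_cong_sets[OF sets_\<mu> refl], rule measurable_restrict_space1) measurable
  \<comment> \<open>The integral of a nonnegative function is zero only if the function vanishes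
    almost everywhere; an exponential vanishes nowhere, so the whole space is a null set.\<close>
  have "AE t in \<mu>. False"
    using assms(2) nn_integral_0_iff_AE[OF meas[of w]]
    by (simp add: laplace_transform_def)
  then have "AE t in \<mu>. ennreal (exp (- z * t)) = 0"
    by (rule AE_mp) simp
  then show ?thesis
    unfolding laplace_transform_def by (simp only: nn_integral_0_iff_AE[OF meas])
qed

theorem propositionC1:
  fixes k c :: real
  assumes "k \<noteq> 0"
  shows "\<not> (\<exists>\<mu> :: real measure. borel_measure_on_nonneg \<mu> \<and>
           (\<forall>z>0. ennreal (heaviside c (k\<^sup>2 - z)) = laplace_transform \<mu> z))"
proof
  assume "\<exists>\<mu> :: real measure. borel_measure_on_nonneg \<mu> \<and>
           (\<forall>z>0. ennreal (heaviside c (k\<^sup>2 - z)) = laplace_transform \<mu> z)"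
  then obtain \<mu> :: "real measure" where \<mu>: "borel_measure_on_nonneg \<mu>"
    and eq: "\<And>z. z > 0 \<Longrightarrow> laplace_transform \<mu> z = ennreal (heaviside c (k\<^sup>2 - z))"
    by metis
  \<comment> \<open>This leaves room for a point of the domain below the jump. For
    \<open>k = 0\<close> the function would be zero on the half-line, the transform of the null
    measure.\<close>
  have pos: "k\<^sup>2 > 0"
    using assms by simp
  \<comment> \<open>The two sample points lie strictly on either side of the jump at
    \<open>k\<^sup>2\<close>, so the values 0 and 1 are the same for every \<open>c\<close>.\<close>
  have "laplace_transform \<mu> (k\<^sup>2 + 1) = 0"
    using pos by (subst eq) (simp_all add: heaviside_def add_pos_pos del: zero_less_power2)
  then have "laplace_transform \<mu> (k\<^sup>2 / 2) = 0"
    by (rule laplace_transform_eq_0[OF \<mu>])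
  moreover have "laplace_transform \<mu> (k\<^sup>2 / 2) = 1"
    using pos by (subst eq) (simp_all add: heaviside_def)
  ultimately show False
    by simp
qed

end
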